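(* Let $I\subset\mathbb R\setminus\{0\}$ be an open interval, $f:I\to\mathbb R$ smooth with $f'^2>1$ everywhere on $I$, and let $C_1\neq0$ be a real constant. Put $$\mathfrak m=-\frac{2\left(3f'^4(1-f'^2)+f'^8-sf'^5f''+s^2f''^2+(4s^2f''^2-1)f'^2+s^2f'f'''+sf'^3(f''-sf''')\right)}{s^3f'(f'^2-1)^{7/2}},$$ $$\mathfrak n=\frac{2\left(f'\left((f'^2-1)^2-3s^2f''^2\right)+s^2(f'^2-1)f'''\right)f'-2s^2f''^2}{C_1s^3f'(f'^2-1)^3},$$ and assume that $\mathfrak m$ and $\mathfrak n$ are non-zero functions. Then the rotational hypersurface $\Gamma^t(s,t,w)=(f(s),\ -s\cos t\sin w,\ -s\sin t,\ s\cos t\cos w)$ in $\mathbb E_1^4$ with Gauss map $N^t=\frac1{\sqrt{f'^2-1}}(1,\ -f'\cos t\sin w,\ -f'\sin t,\ f'\cos t\cos w)$ has generalized $L_1$ 1-type Gauss map; namely $L_1N^t=\mathfrak mN^t+\mathfrak nC$ with $C=(C_1,0,0,0)$.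
   Context: $\mathbb E_1^4$ is $\mathbb R^4$ with the Lorentzian metric $\langle\,,\rangle=-dx_1^2+dx_2^2+dx_3^2+dx_4^2$. Let $M$ be an oriented hypersurface of $\mathbb E_1^4$ with nondegenerate induced metric $g$, unit normal vector field (Gauss map) $N$, $\varepsilon=\langle N,N\rangle=\pm1$, shape operator $S=-dN$ and principal curvatures $\kappa_1,\kappa_2,\kappa_3$. Put $a_0=1$, $a_1=-(\kappa_1+\kappa_2+\kappa_3)$, $a_2=\kappa_1\kappa_2+\kappa_1\kappa_3+\kappa_2\kappa_3$, $a_3=-\kappa_1\kappa_2\kappa_3$. The Newton transformations are $P_0=I$, $P_k=a_kI+S\circ P_{k-1}$, and $L_k(\varphi)=\mathrm{tr}(P_k\circ\nabla^2\varphi)$ for $\varphi\in C^\infty(M)$, where $\nabla^2\varphi$ is the Hessian operator of $\varphi$ with respect to $g$; $L_k$ acts componentwise on $\mathbb R^4$-valued functions such as $N$. With $n=3$, $\binom{n}{k}H_k=(-\varepsilon)^ka_k$ and $C_k=\binom{n}{k+1}(-\varepsilon)^k$, the known formula used for the Gauss map is $L_kN=-\varepsilon C_k\big(\nabla H_{k+1}+(nH_1H_{k+1}-(n-k-1)H_{k+2})N\big)$, where $\nabla$ is the gradient of $g$. $M$ has generalized $L_k$ 1-type Gauss map if $L_kN=\mathfrak mN+\mathfrak nC$ for non-zero (i.e. not identically zero) smooth functions $\mathfrak m,\mathfrak n$ on $M$ and a non-zero constant vector $C\in\mathbb E_1^4$. Primes denote $d/ds$; $s\in I$, $0\le t,w\le2\pi$,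 and the parametrization is considered where it is an immersion ($\cos t\neq0$). *)

theory Defs
  imports "HOL-Analysis.Analysis"
begin

section \<open>Smooth maps\<close>

definition dir_deriv ::
  "'a::euclidean_space \<Rightarrow> ('a \<Rightarrow> 'b::real_normed_vector) \<Rightarrow> 'a \<Rightarrow> 'b" where
  "dir_deriv b F x = frechet_derivative F (at x) b"

text \<open>\<open>C\<^sup>\<infinity>\<close> on an open set: every iterated partial derivative is (totally) differentiable there.\<close>

definition smooth_on ::
  "'a::euclidean_space set \<Rightarrow> ('a \<Rightarrow> 'b::real_normed_vector) \<Rightarrow> bool" where
  "smooth_on U F \<longleftrightarrow>
     (\<forall>bs. set bs \<subseteq> Basis \<longrightarrow> (\<forall>x\<in>U. fold dir_deriv bs F differentiable (at x)))"


section \<open>Hypersurfaces of Minkowski 4-space\<close>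

text \<open>
  A hypersurface is given by an immersion \<open>X\<close> of an open set \<open>U\<close> of parameters in \<open>real^3\<close>.
  Functions and vector fields on it (such as its Gauss map) are functions of the parameter, and
  the tangent space at \<open>X p\<close> is identified with \<open>real^3\<close> through the differential of \<open>X\<close> at \<open>p\<close>,
  so that endomorphisms of the tangent space are \<open>3 \<times> 3\<close> matrices.
\<close>

definition lorentz :: "real^4 \<Rightarrow> real^4 \<Rightarrow> real" where
  "lorentz x y = - (x$1 * y$1) + x$2 * y$2 + x$3 * y$3 + x$4 * y$4"

definition partial :: "3 \<Rightarrow> (real^3 \<Rightarrow> 'b::real_normed_vector) \<Rightarrow> real^3 \<Rightarrow> 'b" where
  "partial i = dir_deriv (axis i 1)"

definition induced_metric :: "(real^3 \<Rightarrow> real^4) \<Rightarrow> real^3 \<Rightarrow> real^3^3" where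
  "induced_metric X p = (\<chi> i j. lorentz (partial i X p) (partial j X p))"

definition hypersurface ::
  "(real^3) set \<Rightarrow> (real^3 \<Rightarrow> real^4) \<Rightarrow> (real^3 \<Rightarrow> real^4) \<Rightarrow> bool" where
  "hypersurface U X N \<longleftrightarrow>
     open U \<and> U \<noteq> {} \<and> smooth_on U X \<and> smooth_on U N \<and>
     (\<forall>p\<in>U. inj (frechet_derivative X (at p)) \<and> invertible (induced_metric X p)) \<and>
     (\<forall>p\<in>U. \<forall>i. lorentz (N p) (partial i X p) = 0) \<and>
     (\<exists>\<epsilon>\<in>{1, -1}. \<forall>p\<in>U. lorentz (N p) (N p) = \<epsilon>)"

text \<open>\<open>S = - dN\<close>.\<close>

definition shape_operator ::
  "(real^3 \<Rightarrow> real^4) \<Rightarrow> (real^3 \<Rightarrow> real^4) \<Rightarrow> real^3 \<Rightarrow> real^3^3" where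
  "shape_operator X N p =
     (THE A. \<forall>v. frechet_derivative X (at p) (A *v v) = - frechet_derivative N (at p) v)"

text \<open>
  The eigenvalues of \<open>S\<close> with algebraic multiplicity, in an arbitrary order. Since the induced
  metric may be indefinite, \<open>S\<close> need not be diagonalizable and may have non-real eigenvalues;
  the symmetric functions of the eigenvalues are nevertheless real, so that \<open>Re\<close> below is only
  a coercion.
\<close>

definition principal_curvatures :: "real^3^3 \<Rightarrow> complex^3" where
  "principal_curvatures S =
     (SOME \<kappa>. \<forall>x. det (mat x - (\<chi> i j. complex_of_real (S$i$j))) =
        (x - \<kappa>$1) * (x - \<kappa>$2) * (x - \<kappa>$3))"

definition acoeff :: "real^3^3 \<Rightarrow> nat \<Rightarrow> real" where
  "acoeff S k =
    (let \<kappa> = principal_curvatures S in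
     if k = 0 then 1
     else if k = 1 then Re (- (\<kappa>$1 + \<kappa>$2 + \<kappa>$3))
     else if k = 2 then Re (\<kappa>$1 * \<kappa>$2 + \<kappa>$1 * \<kappa>$3 + \<kappa>$2 * \<kappa>$3)
     else if k = 3 then Re (- (\<kappa>$1 * \<kappa>$2 * \<kappa>$3))
     else 0)"

primrec newton_transformation :: "real^3^3 \<Rightarrow> nat \<Rightarrow> real^3^3" where
  "newton_transformation S 0 = mat 1"
| "newton_transformation S (Suc k) = mat (acoeff S (Suc k)) + S ** newton_transformation S k"

text \<open>
  Gradient, Levi-Civita connection and Hessian operator of a metric \<open>g\<close> in the coordinates of
  the parameter domain; \<open>christoffel g i j k p\<close> has upper index \<open>i\<close>, and column \<open>j\<close> of
  \<open>covariant_deriv g V p\<close> is the covariant derivative of \<open>V\<close> along the \<open>j\<close>-th coordinate field.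
\<close>

definition gradient :: "(real^3 \<Rightarrow> real^3^3) \<Rightarrow> (real^3 \<Rightarrow> real) \<Rightarrow> real^3 \<Rightarrow> real^3" where
  "gradient g \<phi> p = matrix_inv (g p) *v (\<chi> j. partial j \<phi> p)"

definition christoffel :: "(real^3 \<Rightarrow> real^3^3) \<Rightarrow> 3 \<Rightarrow> 3 \<Rightarrow> 3 \<Rightarrow> real^3 \<Rightarrow> real" where
  "christoffel g i j k p =
     (\<Sum>l\<in>UNIV. matrix_inv (g p) $ i $ l *
        (partial j (\<lambda>q. g q $ l $ k) p + partial k (\<lambda>q. g q $ l $ j) p
          - partial l (\<lambda>q. g q $ j $ k) p)) / 2"

definition covariant_deriv ::
  "(real^3 \<Rightarrow> real^3^3) \<Rightarrow> (real^3 \<Rightarrow> real^3) \<Rightarrow> real^3 \<Rightarrow> real^3^3" where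
  "covariant_deriv g V p =
     (\<chi> i j. partial j (\<lambda>q. V q $ i) p + (\<Sum>k\<in>UNIV. christoffel g i j k p * V p $ k))"

definition hessian_operator ::
  "(real^3 \<Rightarrow> real^3^3) \<Rightarrow> (real^3 \<Rightarrow> real) \<Rightarrow> real^3 \<Rightarrow> real^3^3" where
  "hessian_operator g \<phi> = covariant_deriv g (gradient g \<phi>)"

definition L_op ::
  "nat \<Rightarrow> (real^3 \<Rightarrow> real^4) \<Rightarrow> (real^3 \<Rightarrow> real^4) \<Rightarrow> (real^3 \<Rightarrow> real) \<Rightarrow> real^3 \<Rightarrow> real" where
  "L_op k X N \<phi> p =
     trace (newton_transformation (shape_operator X N p) k **
            hessian_operator (induced_metric X) \<phi> p)"

definition L_vec ::
  "nat \<Rightarrow> (real^3 \<Rightarrow> real^4) \<Rightarrow> (real^3 \<Rightarrow> real^4) \<Rightarrow> (real^3 \<Rightarrow> real^4) \<Rightarrow> real^3 \<Rightarrow> real^4" where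
  "L_vec k X N F p = (\<chi> i. L_op k X N (\<lambda>q. F q $ i) p)"

definition generalized_1_type_with ::
  "nat \<Rightarrow> (real^3) set \<Rightarrow> (real^3 \<Rightarrow> real^4) \<Rightarrow> (real^3 \<Rightarrow> real^4) \<Rightarrow>
   (real^3 \<Rightarrow> real) \<Rightarrow> (real^3 \<Rightarrow> real) \<Rightarrow> real^4 \<Rightarrow> bool" where
  "generalized_1_type_with k U X N m n C \<longleftrightarrow>
     smooth_on U m \<and> smooth_on U n \<and> (\<exists>p\<in>U. m p \<noteq> 0) \<and> (\<exists>p\<in>U. n p \<noteq> 0) \<and> C \<noteq> 0 \<and>
     (\<forall>p\<in>U. L_vec k X N N p = m p *\<^sub>R N p + n p *\<^sub>R C)"

definition generalized_1_type_Gauss_map ::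
  "nat \<Rightarrow> (real^3) set \<Rightarrow> (real^3 \<Rightarrow> real^4) \<Rightarrow> (real^3 \<Rightarrow> real^4) \<Rightarrow> bool" where
  "generalized_1_type_Gauss_map k U X N \<longleftrightarrow>
     hypersurface U X N \<and> (\<exists>m n C. generalized_1_type_with k U X N m n C)"


section \<open>The rotational hypersurface\<close>

text \<open>
  The parameter is \<open>p = (s, t, w)\<close>. The angles range over all reals with \<open>cos t \<noteq> 0\<close>, an open
  domain containing \<open>0 \<le> t, w \<le> 2 * pi\<close>; by periodicity this adds no points to the hypersurface.
\<close>

definition rot_domain :: "real set \<Rightarrow> (real^3) set" where
  "rot_domain I = {p. p$1 \<in> I \<and> cos (p$2) \<noteq> 0}"

definition rot_surface :: "(real \<Rightarrow> real) \<Rightarrow> real^3 \<Rightarrow> real^4" where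
  "rot_surface f p =
    (let s = p$1; t = p$2; w = p$3 in
     vector [f s, - s * cos t * sin w, - s * sin t, s * cos t * cos w])"

definition rot_gauss :: "(real \<Rightarrow> real) \<Rightarrow> real^3 \<Rightarrow> real^4" where
  "rot_gauss f p =
    (let t = p$2; w = p$3; f1 = deriv f (p$1) in
     (1 / sqrt (f1^2 - 1)) *\<^sub>R
       vector [1, - f1 * cos t * sin w, - f1 * sin t, f1 * cos t * cos w])"

definition rot_m :: "(real \<Rightarrow> real) \<Rightarrow> real \<Rightarrow> real" where
  "rot_m f s =
    (let f1 = deriv f s; f2 = (deriv ^^ 2) f s; f3 = (deriv ^^ 3) f s in
     - (2 * (3 * f1^4 * (1 - f1^2) + f1^8 - s * f1^5 * f2 + s^2 * f2^2
             + (4 * s^2 * f2^2 - 1) * f1^2 + s^2 * f1 * f3 + s * f1^3 * (f2 - s * f3)))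
     / (s^3 * f1 * (f1^2 - 1) powr (7/2)))"

definition rot_n :: "real \<Rightarrow> (real \<Rightarrow> real) \<Rightarrow> real \<Rightarrow> real" where
  "rot_n C1 f s =
    (let f1 = deriv f s; f2 = (deriv ^^ 2) f s; f3 = (deriv ^^ 3) f s in
     (2 * (f1 * ((f1^2 - 1)^2 - 3 * s^2 * f2^2) + s^2 * (f1^2 - 1) * f3) * f1 - 2 * s^2 * f2^2)
     / (C1 * s^3 * f1 * (f1^2 - 1)^3))"

end

theory Submission
  imports Defs
begin

text \<open>
  The coordinate fields of the hypersurface are orthogonal, and
  \<open>S\<close> is diagonal with entries \<open>f'' / W^3\<close>, \<open>- f' / (s W)\<close>, \<open>- f' / (s W)\<close> where
  \<open>W = sqrt (f'^2 - 1)\<close>. Hence \<open>L\<^sub>1\<close> separates variables: on \<open>a(s) Y(t, w)\<close> with \<open>Y\<close> an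
  eigenfunction of the spherical Laplacian it is an ordinary differential operator in \<open>s\<close>. The
  components of the Gauss map are \<open>1 / W\<close> and \<open>f' / W\<close> times spherical harmonics of degree one
  (eigenvalue \<open>-2\<close>). The latter determine \<open>m\<close>, and \<open>n C\<^sub>1\<close> is what remains of the former.
\<close>

section \<open>Calculus of smooth maps\<close>

lemma dir_deriv_eqI: "(F has_derivative F') (at x) \<Longrightarrow> dir_deriv b F x = F' b"
  unfolding dir_deriv_def by (metis frechet_derivative_at)

lemma dir_deriv_cong_open:
  assumes "open U" "x \<in> U" "F differentiable (at x)" "\<And>y. y \<in> U \<Longrightarrow> F y = G y"
  shows "dir_deriv b F x = dir_deriv b G x" "G differentiable (at x)"
proof -
  have "(F has_derivative frechet_derivative F (at x)) (at x)"
    using assms(3) frechet_derivative_works by blast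
  then have "(G has_derivative frechet_derivative F (at x)) (at x)"
    by (rule has_derivative_transform_within_open[OF _ assms(1,2,4)])
  then show "dir_deriv b F x = dir_deriv b G x" "G differentiable (at x)"
    using dir_deriv_eqI unfolding dir_deriv_def differentiable_def by metis+
qed

text \<open>Iterating the closure of \<open>R\<close> under basis directions keeps every iterated
  derivative equal, on \<open>U\<close>, to a differentiable member of \<open>R\<close>. Equality on
  \<open>U\<close> is enough because a derivative at a point of an open set depends only on the
  values there.\<close>

lemma smooth_on_coinduct [consumes 2, case_names differentiable dir_deriv]:
  assumes "open U" "R F"
    and diff: "\<And>F x. R F \<Longrightarrow> x \<in> U \<Longrightarrow> F differentiable (at x)"
    and step: "\<And>F b. R F \<Longrightarrow> b \<in> Basis \<Longrightarrow> \<exists>G. R G \<and> (\<forall>x\<in>U. dir_deriv b F x = G x)"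
  shows "smooth_on U F"
proof -
  have "\<exists>G. R G \<and> (\<forall>x\<in>U. fold dir_deriv bs F x = G x)" if "set bs \<subseteq> Basis" for bs
    using that
  \<comment> \<open>\<open>fold\<close> applies the last direction of the list last, so appending a
    direction means one more derivative of a function already replaced by a member of
    \<open>R\<close>.\<close>
  proof (induction bs rule: rev_induct)
    case Nil
    then show ?case using \<open>R F\<close> by auto
  next
    case (snoc b bs)
    then obtain G where G: "R G" "\<forall>x\<in>U. fold dir_deriv bs F x = G x" by auto
    obtain H where H: "R H" "\<forall>x\<in>U. dir_deriv b G x = H x"
      using step[OF G(1), of b] snoc.prems by auto
    have "dir_deriv b (fold dir_deriv bs F) x = dir_deriv b G x" if "x \<in> U" for x
      using dir_deriv_cong_open(1)[OF \<open>open U\<close> that diff[OF G(1) that]] G(2) by metis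
    then show ?case using H by auto
  qed
  then show ?thesis
    unfolding smooth_on_def using dir_deriv_cong_open(2)[OF \<open>open U\<close> _ diff] by metis
qed

lemma smooth_on_differentiable: "smooth_on U F \<Longrightarrow> x \<in> U \<Longrightarrow> F differentiable (at x)"
  unfolding smooth_on_def by (metis empty_subsetI fold_simps(1) list.set(1))

lemma smooth_on_dir_deriv: "smooth_on U F \<Longrightarrow> b \<in> Basis \<Longrightarrow> smooth_on U (dir_deriv b F)"
  unfolding smooth_on_def
  by (metis fold_simps(2) insert_subset list.simps(15))

lemma smooth_on_cong:
  assumes "open U" "smooth_on U F" "\<And>x. x \<in> U \<Longrightarrow> F x = G x"
  shows "smooth_on U G"
proof -
  \<comment> \<open>Smoothness up to equality on \<open>U\<close> is itself a class closed under
    differentiation.\<close>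
  define R where "R G \<longleftrightarrow> (\<exists>F. smooth_on U F \<and> (\<forall>x\<in>U. F x = G x))" for G :: "'a \<Rightarrow> 'b"
  have "R G" using assms R_def by auto
  with \<open>open U\<close> show ?thesis
  proof (induction rule: smooth_on_coinduct)
    case (differentiable G x)
    then show ?case
      unfolding R_def using dir_deriv_cong_open(2)[OF \<open>open U\<close>] smooth_on_differentiable by metis
  next
    case (dir_deriv G b)
    then obtain F where F: "smooth_on U F" "\<forall>x\<in>U. F x = G x" unfolding R_def by auto
    have "dir_deriv b F x = dir_deriv b G x" if "x \<in> U" for x
      using dir_deriv_cong_open(1)[OF \<open>open U\<close> that] F smooth_on_differentiable that by metis
    then show ?case
      using F(1) smooth_on_dir_deriv dir_deriv unfolding R_def by metis
  qed
qed

lemma smooth_on_const: "open U \<Longrightarrow> smooth_on U (\<lambda>x. c)"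
  by (rule smooth_on_coinduct[where R = "\<lambda>F. F \<in> range (\<lambda>c x. c)"])
    (auto simp: dir_deriv_def)

lemma smooth_on_bounded_linear:
  assumes "open U" "bounded_linear F"
  shows "smooth_on U F"
proof -
  \<comment> \<open>The differential of a linear map is the same at every point, so adding the
    constant functions makes the class closed under derivatives.\<close>
  have "bounded_linear F \<or> (\<exists>c. F = (\<lambda>x. c))" using assms by simp
  with \<open>open U\<close> show ?thesis
  proof (induction rule: smooth_on_coinduct[where R = "\<lambda>F. bounded_linear F \<or> (\<exists>c. F = (\<lambda>x. c))"])
    case (differentiable F x)
    then show ?case using bounded_linear_imp_differentiable by auto
  next
    case (dir_deriv F b)
    then have "\<exists>c. \<forall>x. dir_deriv b F x = c"
      by (metis bounded_linear_imp_has_derivative dir_deriv_eqI has_derivative_const)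
    then show ?case by auto
  qed
qed

text \<open>The derivative of a product is not again a product, nor that of a composition a composition;
  this closure contains both, so that coinduction applies to it.\<close>

inductive smooth_closure :: "'a::euclidean_space set \<Rightarrow> ('a \<Rightarrow> real) \<Rightarrow> bool" for U where
  base: "smooth_on U F \<Longrightarrow> smooth_closure U F"
| add: "smooth_closure U F \<Longrightarrow> smooth_closure U G \<Longrightarrow> smooth_closure U (\<lambda>x. F x + G x)"
| mult: "smooth_closure U F \<Longrightarrow> smooth_closure U G \<Longrightarrow> smooth_closure U (\<lambda>x. F x * G x)"
| comp: "smooth_closure U F \<Longrightarrow> smooth_on V h \<Longrightarrow> F ` U \<subseteq> V \<Longrightarrow> smooth_closure U (\<lambda>x. h (F x))"
  for h :: "real \<Rightarrow> real"

lemma smooth_closure_differentiable: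
  "smooth_closure U F \<Longrightarrow> x \<in> U \<Longrightarrow> F differentiable (at x)"
proof (induction rule: smooth_closure.induct)
  case (comp h F V)
  then have "h differentiable (at (F x))"
    by (intro smooth_on_differentiable[OF comp.hyps(2)]) blast
  with differentiable_chain_at[OF comp.IH[OF comp.prems]] show ?case by (simp add: o_def)
qed (auto intro: smooth_on_differentiable)

lemma dir_deriv_add:
  fixes F G :: "'a::euclidean_space \<Rightarrow> real"
  assumes "F differentiable (at x)" "G differentiable (at x)"
  shows "dir_deriv b (\<lambda>x. F x + G x) x = dir_deriv b F x + dir_deriv b G x"
  using assms unfolding frechet_derivative_works
  by (intro dir_deriv_eqI[THEN trans, OF has_derivative_add]) (auto simp: dir_deriv_def)

lemma dir_deriv_mult:
  fixes F G :: "'a::euclidean_space \<Rightarrow> real"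
  assumes "F differentiable (at x)" "G differentiable (at x)"
  shows "dir_deriv b (\<lambda>x. F x * G x) x = F x * dir_deriv b G x + dir_deriv b F x * G x"
  using assms unfolding frechet_derivative_works
  by (intro dir_deriv_eqI[THEN trans, OF has_derivative_mult]) (auto simp: dir_deriv_def)

text \<open>A linear map on the real line is multiplication by its value at \<open>1\<close>, which
  gives the chain rule the product form that \<open>smooth_closure\<close> contains.\<close>

lemma dir_deriv_comp:
  fixes F :: "'a::euclidean_space \<Rightarrow> real" and h :: "real \<Rightarrow> real"
  assumes "F differentiable (at x)" "h differentiable (at (F x))"
  shows "dir_deriv b (\<lambda>x. h (F x)) x = dir_deriv 1 h (F x) * dir_deriv b F x"
proof -
  have "dir_deriv b (\<lambda>x. h (F x)) x = frechet_derivative h (at (F x)) (dir_deriv b F x)"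
    using frechet_derivative_compose[OF assms] by (simp add: dir_deriv_def o_def)
  also have "\<dots> = dir_deriv 1 h (F x) * dir_deriv b F x"
    using linear_cmul[OF linear_frechet_derivative[OF assms(2)], of "dir_deriv b F x" 1]
    by (simp add: dir_deriv_def)
  finally show ?thesis .
qed

text \<open>The sum, product and chain rules express the derivative through sums and products of
  members; the outer derivative \<open>dir_deriv 1 h\<close> is again smooth on \<open>V\<close>, so
  its composition with \<open>F\<close> is a member too.\<close>

lemma smooth_closure_dir_deriv:
  assumes "smooth_closure U F" "b \<in> Basis"
  shows "\<exists>G. smooth_closure U G \<and> (\<forall>x\<in>U. dir_deriv b F x = G x)"
  using assms(1)
proof (induction rule: smooth_closure.induct)
  case (base F)
  then have "smooth_closure U (dir_deriv b F)"
    by (simp add: smooth_closure.base smooth_on_dir_deriv assms(2))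
  then show ?case by (intro exI[of _ "dir_deriv b F"]) simp
next
  case (add F G)
  then obtain F' G' where "smooth_closure U F'" "\<forall>x\<in>U. dir_deriv b F x = F' x"
    "smooth_closure U G'" "\<forall>x\<in>U. dir_deriv b G x = G' x" by auto
  then show ?case
    using add.hyps
    by (intro exI[of _ "\<lambda>x. F' x + G' x"])
      (simp add: smooth_closure.add dir_deriv_add smooth_closure_differentiable)
next
  case (mult F G)
  then obtain F' G' where "smooth_closure U F'" "\<forall>x\<in>U. dir_deriv b F x = F' x"
    "smooth_closure U G'" "\<forall>x\<in>U. dir_deriv b G x = G' x" by auto
  then show ?case
    using mult.hyps
    by (intro exI[of _ "\<lambda>x. F x * G' x + F' x * G x"])
      (simp add: smooth_closure.add smooth_closure.mult dir_deriv_mult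
        smooth_closure_differentiable)
next
  case (comp h F V)
  then obtain F' where F': "smooth_closure U F'" "\<forall>x\<in>U. dir_deriv b F x = F' x" by auto
  have "smooth_closure U (\<lambda>x. dir_deriv 1 h (F x))"
    using smooth_closure.comp[OF comp.hyps(1) smooth_on_dir_deriv[OF comp.hyps(2)] comp.hyps(3)]
    by simp
  moreover have "dir_deriv b (\<lambda>x. h (F x)) x = dir_deriv 1 h (F x) * F' x" if "x \<in> U" for x
    using dir_deriv_comp[OF smooth_closure_differentiable[OF comp.hyps(1) that]
        smooth_on_differentiable[OF comp.hyps(2)]] comp.hyps(3) F' that
    by (simp add: image_subset_iff)
  ultimately show ?case
    using F' by (intro exI[of _ "\<lambda>x. dir_deriv 1 h (F x) * F' x"]) (simp add: smooth_closure.mult)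
qed

lemma smooth_on_closure: "open U \<Longrightarrow> smooth_closure U F \<Longrightarrow> smooth_on U F"
  by (rule smooth_on_coinduct[where R = "smooth_closure U"])
    (auto intro: smooth_closure_differentiable smooth_closure_dir_deriv)

lemma smooth_on_add:
  fixes F G :: "'a::euclidean_space \<Rightarrow> real"
  shows "open U \<Longrightarrow> smooth_on U F \<Longrightarrow> smooth_on U G \<Longrightarrow> smooth_on U (\<lambda>x. F x + G x)"
  by (simp add: smooth_on_closure smooth_closure.add smooth_closure.base)

lemma smooth_on_mult:
  fixes F G :: "'a::euclidean_space \<Rightarrow> real"
  shows "open U \<Longrightarrow> smooth_on U F \<Longrightarrow> smooth_on U G \<Longrightarrow> smooth_on U (\<lambda>x. F x * G x)"
  by (simp add: smooth_on_closure smooth_closure.mult smooth_closure.base)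

lemma smooth_on_compose:
  fixes F :: "'a::euclidean_space \<Rightarrow> real" and h :: "real \<Rightarrow> real"
  assumes "open U" "smooth_on U F" "smooth_on V h" "\<And>x. x \<in> U \<Longrightarrow> F x \<in> V"
  shows "smooth_on U (\<lambda>x. h (F x))"
  using smooth_closure.comp[OF smooth_closure.base[OF assms(2)] assms(3)] assms(1,4)
  by (simp add: smooth_on_closure image_subset_iff)

lemma smooth_on_uminus:
  fixes F :: "'a::euclidean_space \<Rightarrow> real"
  shows "open U \<Longrightarrow> smooth_on U F \<Longrightarrow> smooth_on U (\<lambda>x. - F x)"
  using smooth_on_mult[of U "\<lambda>x. - 1" F] by (simp add: smooth_on_const)

lemma smooth_on_diff:
  fixes F G :: "'a::euclidean_space \<Rightarrow> real"
  shows "open U \<Longrightarrow> smooth_on U F \<Longrightarrow> smooth_on U G \<Longrightarrow> smooth_on U (\<lambda>x. F x - G x)"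
  using smooth_on_add[of U F "\<lambda>x. - G x"] by (simp add: smooth_on_uminus)

lemma smooth_on_power:
  fixes F :: "'a::euclidean_space \<Rightarrow> real"
  shows "open U \<Longrightarrow> smooth_on U F \<Longrightarrow> smooth_on U (\<lambda>x. F x ^ k)"
  by (induction k) (auto intro: smooth_on_const smooth_on_mult)

section \<open>Smoothness of elementary functions and of vector-valued maps\<close>

lemma dir_deriv_real: "(h has_real_derivative D) (at x) \<Longrightarrow> dir_deriv 1 h x = D"
  unfolding has_field_derivative_def by (simp add: dir_deriv_eqI)

lemma smooth_on_powr: "smooth_on {0<..} (\<lambda>x. x powr a :: real)"
proof -
  \<comment> \<open>Multiples of real powers form a class closed under differentiation, since the
    exponent that comes down is absorbed into \<open>c\<close>.\<close>
  define R where "R F \<longleftrightarrow> (\<exists>c a. F = (\<lambda>x. c * x powr a))" for F :: "real \<Rightarrow> real"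
  have R: "R (\<lambda>x. c * x powr a)" for c a unfolding R_def by blast
  have "R (\<lambda>x. x powr a)" using R[of 1 a] by simp
  with open_greaterThan[of "0::real"] show ?thesis
  proof (induction rule: smooth_on_coinduct)
    case (differentiable F x)
    then obtain c a where F: "F = (\<lambda>x. c * x powr a)" unfolding R_def by blast
    have "(F has_real_derivative c * (a * x powr (a - 1))) (at x)"
      unfolding F using differentiable by (auto intro!: derivative_eq_intros)
    then show ?case by (auto simp: has_field_derivative_def differentiable_def)
  next
    case (dir_deriv F b)
    then obtain c a where F: "F = (\<lambda>x. c * x powr a)" unfolding R_def by blast
    have "(F has_real_derivative c * a * x powr (a - 1)) (at x)" if "x > 0" for x
      unfolding F using that by (auto intro!: derivative_eq_intros)
    then have "\<forall>x\<in>{0<..}. dir_deriv b F x = c * a * x powr (a - 1)"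
      using dir_deriv dir_deriv_real by auto
    then show ?case using R by blast
  qed
qed

lemma smooth_on_sqrt: "smooth_on {0<..} sqrt"
  by (rule smooth_on_cong[OF _ smooth_on_powr[of "1/2"]]) (auto simp: powr_half_sqrt)

lemma smooth_on_inverse: "smooth_on (- {0}) (inverse :: real \<Rightarrow> real)"
proof -
  define R where "R F \<longleftrightarrow> (\<exists>c k. F = (\<lambda>x::real. c * inverse x ^ k))" for F :: "real \<Rightarrow> real"
  have R: "R (\<lambda>x. c * inverse x ^ k)" for c k unfolding R_def by blast
  have "R inverse" using R[of 1 1] by simp
  with open_Compl[OF closed_singleton[of "0::real"]] show ?thesis
  proof (induction rule: smooth_on_coinduct)
    case (differentiable F x)
    then show ?case
      unfolding R_def by (auto intro!: derivative_intros simp del: power_inverse)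
  next
    case (dir_deriv F b)
    then obtain c k where F: "F = (\<lambda>x. c * inverse x ^ k)" unfolding R_def by blast
    have "(F has_real_derivative - (c * k) * inverse x ^ Suc k) (at x)" if "x \<noteq> 0" for x
      unfolding F using DERIV_cmult[OF DERIV_power[OF DERIV_inverse[OF that]], of c k]
      \<comment> \<open>For \<open>k = 0\<close> the exponent \<open>k - 1\<close> is truncated, but
        then the coefficient \<open>k\<close> vanishes; for a successor the powers of
        \<open>inverse x\<close> merge.\<close>
      by (cases k) (simp_all add: mult_ac)
    then have "\<forall>x\<in>-{0}. dir_deriv b F x = - (c * k) * inverse x ^ Suc k"
      using dir_deriv dir_deriv_real by auto
    then show ?case using R by blast
  qed
qed

lemma smooth_on_divide:
  fixes F G :: "'a::euclidean_space \<Rightarrow> real"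
  assumes "open U" "smooth_on U F" "smooth_on U G" "\<And>x. x \<in> U \<Longrightarrow> G x \<noteq> 0"
  shows "smooth_on U (\<lambda>x. F x / G x)"
  unfolding divide_inverse using assms
  by (intro smooth_on_mult smooth_on_compose[OF _ _ smooth_on_inverse]) auto

lemma smooth_on_sin_cos: "smooth_on UNIV (sin :: real \<Rightarrow> real)" "smooth_on UNIV (cos :: real \<Rightarrow> real)"
proof -
  \<comment> \<open>Differentiation permutes these four functions cyclically.\<close>
  define R :: "(real \<Rightarrow> real) \<Rightarrow> bool"
    where "R F \<longleftrightarrow> F = sin \<or> F = cos \<or> F = (\<lambda>x. - sin x) \<or> F = (\<lambda>x. - cos x)" for F
  have *: "smooth_on UNIV F" if "R F" for F
    using open_UNIV that
  proof (induction rule: smooth_on_coinduct)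
    case (differentiable F x)
    have "sin differentiable at x" "cos differentiable at x" "(\<lambda>x. - sin x) differentiable at x"
      "(\<lambda>x. - cos x) differentiable at x"
      using DERIV_sin[of x] DERIV_cos[of x] DERIV_minus[OF DERIV_sin[of x]]
        DERIV_minus[OF DERIV_cos[of x]]
      by (auto simp: differentiable_def has_field_derivative_def)
    then show ?case using differentiable unfolding R_def by auto
  next
    case (dir_deriv F b)
    have "dir_deriv 1 (sin :: real \<Rightarrow> real) = cos" "dir_deriv 1 cos = (\<lambda>x::real. - sin x)"
      "dir_deriv 1 (\<lambda>x. - sin x) = (\<lambda>x::real. - cos x)"
      "dir_deriv 1 (\<lambda>x. - cos x) = (sin :: real \<Rightarrow> real)"
      by (auto simp: fun_eq_iff intro!: dir_deriv_real DERIV_sin DERIV_cos derivative_eq_intros)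
    then have "R (dir_deriv b F)" using dir_deriv unfolding R_def by auto
    then show ?case by blast
  qed
  show "smooth_on UNIV (sin :: real \<Rightarrow> real)" "smooth_on UNIV (cos :: real \<Rightarrow> real)"
    by (simp_all add: * R_def)
qed

lemma has_derivative_vecI:
  fixes F :: "'a::real_normed_vector \<Rightarrow> real^'n"
  assumes "\<And>i. ((\<lambda>x. F x $ i) has_derivative (\<lambda>h. F' h $ i)) (at x)"
  shows "(F has_derivative F') (at x)"
  using assms
  by (subst has_derivative_componentwise_within)
    (auto simp: Basis_vec_def inner_axis)

lemma smooth_on_vecI:
  fixes F :: "'a::euclidean_space \<Rightarrow> real^'n"
  assumes "open U" "\<And>i. smooth_on U (\<lambda>x. F x $ i)"
  shows "smooth_on U F"
proof -
  let ?R = "\<lambda>F :: 'a \<Rightarrow> real^'n. \<forall>i. smooth_on U (\<lambda>x. F x $ i)"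
  have D: "(F has_derivative (\<lambda>h. \<chi> i. frechet_derivative (\<lambda>x. F x $ i) (at x) h)) (at x)"
    if "?R F" "x \<in> U" for F x
    using that smooth_on_differentiable
    by (intro has_derivative_vecI) (auto simp: frechet_derivative_works[symmetric] fun_eq_iff)
  have "?R F" using assms by simp
  with \<open>open U\<close> show ?thesis
  proof (induction rule: smooth_on_coinduct)
    case (differentiable F x)
    then show ?case using D differentiable_def by metis
  next
    case (dir_deriv F b)
    have "dir_deriv b F x = (\<chi> i. dir_deriv b (\<lambda>x. F x $ i) x)" if "x \<in> U" for x
      using dir_deriv_eqI[OF D[OF _ that]] dir_deriv(1) by (simp add: dir_deriv_def)
    moreover have "?R (\<lambda>x. \<chi> i. dir_deriv b (\<lambda>x. F x $ i) x)"
      using dir_deriv smooth_on_dir_deriv by auto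
    ultimately show ?case
      by (intro exI[of _ "\<lambda>x. \<chi> i. dir_deriv b (\<lambda>x. F x $ i) x"]) simp
  qed
qed

section \<open>Hypersurfaces with a diagonal metric\<close>

lemma partial_eqI: "(F has_derivative F') (at p) \<Longrightarrow> partial i F p = F' (axis i 1)"
  by (simp add: partial_def dir_deriv_eqI)

lemma partial_cong_open:
  assumes "open U" "p \<in> U" "F differentiable (at p)" "\<And>q. q \<in> U \<Longrightarrow> F q = G q"
  shows "partial i F p = partial i G p"
  unfolding partial_def using dir_deriv_cong_open(1)[OF assms] .

lemma frechet_derivative_eq_sum_partial:
  assumes "F differentiable (at p)"
  shows "frechet_derivative F (at p) v = (\<Sum>i\<in>UNIV. v $ i *\<^sub>R partial i F p)"
proof -
  have "frechet_derivative F (at p) (\<Sum>i\<in>UNIV. v $ i *\<^sub>R axis i 1)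
    = (\<Sum>i\<in>UNIV. v $ i *\<^sub>R partial i F p)"
    using linear_frechet_derivative[OF assms]
    by (simp add: linear_sum linear_cmul partial_def dir_deriv_def)
  moreover have "(\<Sum>i\<in>UNIV. v $ i *\<^sub>R axis i 1) = v"
    using basis_expansion[of v] by (simp add: scalar_mult_eq_scaleR)
  ultimately show ?thesis by simp
qed

lemma lorentz_sum_right:
  "lorentz x (\<Sum>i\<in>A. c i *\<^sub>R y i) = (\<Sum>i\<in>A. c i * lorentz x (y i))"
  by (induction A rule: infinite_finite_induct) (auto simp: lorentz_def algebra_simps)

text \<open>The induced metric is the Gram matrix of the coordinate fields: pairing
  \<open>dX v\<close> with each of them gives the entries of \<open>g v\<close>, so a kernel vector
  of \<open>dX\<close> lies in the kernel of \<open>g\<close>.\<close>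

lemma inj_if_invertible_induced_metric:
  assumes "X differentiable (at p)" "invertible (induced_metric X p)"
  shows "inj (frechet_derivative X (at p))"
proof (subst linear_injective_0[OF linear_frechet_derivative[OF assms(1)]], intro allI impI)
  fix v assume v: "frechet_derivative X (at p) v = 0"
  have "induced_metric X p *v v = 0"
  proof (rule vec_eq_iff[THEN iffD2], rule allI)
    fix j
    have "(induced_metric X p *v v) $ j = lorentz (partial j X p) (frechet_derivative X (at p) v)"
      by (simp add: frechet_derivative_eq_sum_partial[OF assms(1)] lorentz_sum_right
          matrix_vector_mult_def induced_metric_def mult.commute)
    then show "(induced_metric X p *v v) $ j = 0 $ j" by (simp add: v lorentz_def)
  qed
  then show "v = 0"
    using assms(2) by (metis invertible_left_inverse matrix_left_invertible_ker)
qed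

section \<open>Diagonal matrices, shape operators and Hessians\<close>

definition diag :: "'a::zero^'n \<Rightarrow> 'a^'n^'n" where
  "diag d = (\<chi> i j. if i = j then d $ i else 0)"

lemma diag_mult_vec: "diag d *v v = (\<chi> i. d $ i * v $ i)"
  for d :: "'a::semiring_1^'n"
  by (simp add: vec_eq_iff diag_def matrix_vector_mult_def if_distrib[of "\<lambda>x. x * _"] cong: if_cong)

lemma diag_mult_component: "(diag d ** A) $ i $ j = d $ i * A $ i $ j"
  for d :: "'a::semiring_1^'n"
  by (simp add: diag_def matrix_matrix_mult_def if_distrib[of "\<lambda>x. x * _"] cong: if_cong)

lemma
  fixes d :: "real^'n"
  assumes "\<And>i. d $ i \<noteq> 0"
  shows invertible_diag: "invertible (diag d)"
    and matrix_inv_diag: "matrix_inv (diag d) = diag (\<chi> i. inverse (d $ i))"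
proof -
  let ?B = "diag (\<chi> i. inverse (d $ i))"
  have "diag d ** ?B = mat 1" "?B ** diag d = mat 1"
    using assms by (auto simp: vec_eq_iff diag_mult_component) (auto simp: diag_def mat_def)
  then show inv: "invertible (diag d)" by (auto simp: invertible_def)
  \<comment> \<open>\<open>matrix_inv\<close> is a choice among two-sided inverses. The property of
    the chosen one is extracted first, then associativity identifies it with
    \<open>?B\<close>.\<close>
  have "matrix_inv (diag d) ** diag d = mat 1"
    unfolding matrix_inv_def
    by (rule someI2[of _ ?B]) (simp_all add: \<open>diag d ** ?B = mat 1\<close> \<open>?B ** diag d = mat 1\<close>)
  then have "?B = (matrix_inv (diag d) ** diag d) ** ?B" by simp
  also have "\<dots> = matrix_inv (diag d)"
    using \<open>diag d ** ?B = mat 1\<close> by (simp flip: matrix_mul_assoc)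
  finally show "matrix_inv (diag d) = ?B" by simp
qed

text \<open>The last hypothesis makes the coordinate fields principal directions. Injectivity of
  \<open>dX\<close> gives the uniqueness demanded by the definite description in
  \<open>shape_operator\<close>.\<close>

lemma shape_operator_diag:
  assumes "X differentiable (at p)" "N differentiable (at p)" "inj (frechet_derivative X (at p))"
    and N: "\<And>i. partial i N p = - (\<kappa> $ i) *\<^sub>R partial i X p"
  shows "shape_operator X N p = diag \<kappa>"
  unfolding shape_operator_def
proof (rule the_equality)
  show *: "\<forall>v. frechet_derivative X (at p) (diag \<kappa> *v v) = - frechet_derivative N (at p) v"
    by (simp add: frechet_derivative_eq_sum_partial assms diag_mult_vec sum_negf mult.commute)
  fix A assume "\<forall>v. frechet_derivative X (at p) (A *v v) = - frechet_derivative N (at p) v"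
  with * assms(3) have "A *v v = diag \<kappa> *v v" for v by (metis injD)
  then show "A = diag \<kappa>" by (simp add: matrix_eq)
qed

text \<open>The sum of the roots of a monic cubic is determined by its values at \<open>0\<close>, \<open>1\<close> and \<open>-1\<close>.\<close>

lemma acoeff_diag_1: "acoeff (diag \<kappa>) 1 = - (\<kappa>$1 + \<kappa>$2 + \<kappa>$3)"
proof -
  let ?k = "\<lambda>i. complex_of_real (\<kappa> $ i)"
  have char: "det (mat x - (\<chi> i j. complex_of_real (diag \<kappa> $ i $ j))) =
    (x - ?k 1) * (x - ?k 2) * (x - ?k 3)" for x
    by (simp add: det_3 diag_def mat_def)
  define c where "c = principal_curvatures (diag \<kappa>)"
  have c: "\<forall>x. (x - ?k 1) * (x - ?k 2) * (x - ?k 3) = (x - c$1) * (x - c$2) * (x - c$3)"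
    unfolding c_def principal_curvatures_def char
    \<comment> \<open>The diagonal entries are one admissible choice of roots, so the triple
      actually chosen factors the same characteristic polynomial, possibly in another order.\<close>
    by (rule someI[of _ "\<chi> i. ?k i"]) simp
  have "c$1 + c$2 + c$3 = ?k 1 + ?k 2 + ?k 3"
    using c[rule_format, of 0] c[rule_format, of 1] c[rule_format, of "-1"]
    by algebra
  then have "Re (- (c$1 + c$2 + c$3)) = - (\<kappa>$1 + \<kappa>$2 + \<kappa>$3)" by simp
  then show ?thesis by (simp add: acoeff_def Let_def c_def)
qed

text \<open>\<open>P_1 = a_1 I + S\<close>, so each entry is minus the sum of the other two
  principal curvatures.\<close>

lemma newton_transformation_diag_1:
  "newton_transformation (diag \<kappa>) 1 = diag (\<chi> i. \<kappa> $ i - (\<kappa>$1 + \<kappa>$2 + \<kappa>$3))"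
  using acoeff_diag_1[of \<kappa>] by (simp add: vec_eq_iff) (simp add: diag_def mat_def)

text \<open>Against a diagonal matrix the trace sees only the Christoffel symbols whose upper index
  equals the direction of differentiation. For a diagonal metric two of their three terms cancel,
  leaving half a logarithmic derivative of \<open>E\<close>. The quotients
  \<open>partial i \<phi> / E $ i\<close> are the gradient components.\<close>

lemma trace_diag_hessian:
  assumes U: "open U" "p \<in> U"
    and g: "\<And>q. q \<in> U \<Longrightarrow> g q = diag (E q)"
    and E: "\<And>q i. q \<in> U \<Longrightarrow> E q $ i \<noteq> 0"
    and dE: "\<And>i. (\<lambda>q. E q $ i) differentiable (at p)"
    and dV: "\<And>i. (\<lambda>q. partial i \<phi> q / E q $ i) differentiable (at p)"
  shows "trace (diag d ** hessian_operator g \<phi> p) =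
    (\<Sum>i\<in>UNIV. d $ i * (partial i (\<lambda>q. partial i \<phi> q / E q $ i) p +
      (\<Sum>k\<in>UNIV. partial k (\<lambda>q. E q $ i) p / (2 * E p $ i) * (partial k \<phi> p / E p $ k))))"
proof -
  have inv: "matrix_inv (g q) = diag (\<chi> i. inverse (E q $ i))" if "q \<in> U" for q
    using g E that by (simp add: matrix_inv_diag)
  have grad: "gradient g \<phi> q $ i = partial i \<phi> q / E q $ i" if "q \<in> U" for q i
    using that by (simp add: gradient_def inv diag_mult_vec field_simps)
  have dgrad: "partial k (\<lambda>q. gradient g \<phi> q $ i) p = partial k (\<lambda>q. partial i \<phi> q / E q $ i) p" for i k
    by (rule partial_cong_open[OF U dV, symmetric]) (simp add: grad)
  have dg: "partial k (\<lambda>q. g q $ i $ i) p = partial k (\<lambda>q. E q $ i) p" for i k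
    by (rule partial_cong_open[OF U dE, symmetric]) (simp add: g diag_def)
  have "christoffel g i i k p = partial k (\<lambda>q. E q $ i) p / (2 * E p $ i)" for i k
    unfolding christoffel_def inv[OF U(2)]
    by (simp add: diag_def dg if_distrib[of "\<lambda>x. x * _"] field_simps cong: if_cong)
  then show ?thesis
    by (simp add: trace_def diag_mult_component hessian_operator_def covariant_deriv_def
        dgrad grad[OF U(2)])
qed

lemma vector_4:
  "(vector [x, y, z, u] :: 'a::zero^4) $ 1 = x" "(vector [x, y, z, u] :: 'a^4) $ 2 = y"
  "(vector [x, y, z, u] :: 'a^4) $ 3 = z" "(vector [x, y, z, u] :: 'a^4) $ 4 = u"
  by (simp_all add: vector_def)

section \<open>Separable functions\<close>

definition separable ::
  "(real \<Rightarrow> real) \<Rightarrow> (real \<Rightarrow> real) \<Rightarrow> (real \<Rightarrow> real) \<Rightarrow> real^3 \<Rightarrow> real" where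
  "separable a b c p = a (p$1) * b (p$2) * c (p$3)"

lemma separable_has_derivative:
  assumes "(a has_real_derivative a') (at (p$1))" "(b has_real_derivative b') (at (p$2))"
    "(c has_real_derivative c') (at (p$3))"
  shows "(separable a b c has_derivative (\<lambda>h. a' * b (p$2) * c (p$3) * h$1 +
    a (p$1) * b' * c (p$3) * h$2 + a (p$1) * b (p$2) * c' * h$3)) (at p)"
proof -
  have comp: "((\<lambda>q::real^3. k (q$i)) has_derivative (\<lambda>h. k' * h$i)) (at p)"
    if "(k has_real_derivative k') (at (p$i))" for k k' i
    using has_derivative_compose[OF bounded_linear_imp_has_derivative[OF bounded_linear_vec_nth]]
      that by (auto simp: has_field_derivative_def)
  show ?thesis
    unfolding separable_def
    by (rule has_derivative_eq_rhs[OF has_derivative_mult[OF has_derivative_mult]])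
      (auto intro!: comp assms simp: algebra_simps)
qed

lemma
  assumes "(a has_real_derivative a') (at (p$1))" "(b has_real_derivative b') (at (p$2))"
    "(c has_real_derivative c') (at (p$3))"
  shows separable_differentiable: "separable a b c differentiable (at p)"
    and partial_separable:
      "partial 1 (separable a b c) p = a' * b (p$2) * c (p$3)"
      "partial 2 (separable a b c) p = a (p$1) * b' * c (p$3)"
      "partial 3 (separable a b c) p = a (p$1) * b (p$2) * c'"
  using separable_has_derivative[OF assms]
  by (auto simp: partial_eqI axis_def differentiable_def)

lemma smooth_on_separable:
  assumes "open U" "smooth_on I a" "smooth_on J b" "smooth_on K c"
    "\<And>p. p \<in> U \<Longrightarrow> p$1 \<in> I" "\<And>p. p \<in> U \<Longrightarrow> p$2 \<in> J" "\<And>p. p \<in> U \<Longrightarrow> p$3 \<in> K"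
  shows "smooth_on U (separable a b c)"
proof -
  have "smooth_on U (\<lambda>p. a (p$1))" "smooth_on U (\<lambda>p. b (p$2))" "smooth_on U (\<lambda>p. c (p$3))"
    using assms smooth_on_bounded_linear[OF assms(1) bounded_linear_vec_nth]
    by (auto intro: smooth_on_compose)
  then show ?thesis
    unfolding separable_def using assms(1) by (intro smooth_on_mult)
qed

section \<open>Rotational hypersurfaces\<close>

text \<open>The common shape of the hypersurface and its Gauss map: \<open>u\<close> and
  \<open>v\<close> are \<open>f\<close> and \<open>s\<close> for the former, \<open>1 / W\<close>
  and \<open>f' / W\<close> for the latter. The last three entries are \<open>v\<close> times a
  point of the unit sphere.\<close>

definition rot_map :: "(real \<Rightarrow> real) \<Rightarrow> (real \<Rightarrow> real) \<Rightarrow> real^3 \<Rightarrow> real^4" where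
  "rot_map u v p = vector [u (p$1), - v (p$1) * cos (p$2) * sin (p$3), - v (p$1) * sin (p$2),
    v (p$1) * cos (p$2) * cos (p$3)]"

text \<open>The derivative of the spherical point in \<open>t\<close>; \<open>rot_frame3\<close> is
  its derivative in \<open>w\<close> divided by \<open>cos t\<close>. Together they form an
  orthonormal tangent frame of the sphere.\<close>

definition rot_frame2 :: "real^3 \<Rightarrow> real^4" where
  "rot_frame2 p = vector [0, sin (p$2) * sin (p$3), - cos (p$2), - sin (p$2) * cos (p$3)]"

definition rot_frame3 :: "real^3 \<Rightarrow> real^4" where
  "rot_frame3 p = vector [0, - cos (p$3), 0, - sin (p$3)]"

lemma rot_map_component:
  "(\<lambda>p. rot_map u v p $ 1) = separable u (\<lambda>_. 1) (\<lambda>_. 1)"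
  "(\<lambda>p. rot_map u v p $ 2) = separable (\<lambda>s. - v s) cos sin"
  "(\<lambda>p. rot_map u v p $ 3) = separable (\<lambda>s. - v s) sin (\<lambda>_. 1)"
  "(\<lambda>p. rot_map u v p $ 4) = separable v cos cos"
  by (auto simp: rot_map_def separable_def vector_4)

lemma smooth_on_rot_map:
  assumes "open I" "open U" "smooth_on I u" "smooth_on I v" "\<And>p. p \<in> U \<Longrightarrow> p$1 \<in> I"
  shows "smooth_on U (rot_map u v)"
proof (rule smooth_on_vecI[OF assms(2)])
  fix i :: 4
  have "\<forall>i. smooth_on U (\<lambda>p. rot_map u v p $ i)"
    unfolding forall_4 rot_map_component
    using assms smooth_on_sin_cos smooth_on_const[OF open_UNIV]
    by (auto intro: smooth_on_separable smooth_on_uminus)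
  then show "smooth_on U (\<lambda>p. rot_map u v p $ i)" ..
qed

lemma
  assumes "(u has_real_derivative u') (at (p$1))" "(v has_real_derivative v') (at (p$1))"
  shows partial_rot_map:
      "partial 1 (rot_map u v) p = rot_map (\<lambda>_. u') (\<lambda>_. v') p"
      "partial 2 (rot_map u v) p = v (p$1) *\<^sub>R rot_frame2 p"
      "partial 3 (rot_map u v) p = (v (p$1) * cos (p$2)) *\<^sub>R rot_frame3 p"
proof -
  have one: "((\<lambda>_. 1) has_real_derivative 0) (at x)" for x :: real by simp
  note sep = separable_has_derivative
  have "(rot_map u v has_derivative (\<lambda>h. h$1 *\<^sub>R rot_map (\<lambda>_. u') (\<lambda>_. v') p +
    h$2 *\<^sub>R v (p$1) *\<^sub>R rot_frame2 p + h$3 *\<^sub>R (v (p$1) * cos (p$2)) *\<^sub>R rot_frame3 p)) (at p)"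
    (is "(_ has_derivative ?D) _")
  proof (rule has_derivative_vecI)
    fix i :: 4
    have "\<forall>i. ((\<lambda>q. rot_map u v q $ i) has_derivative (\<lambda>h. ?D h $ i)) (at p)"
      unfolding forall_4 rot_map_component
      by (intro conjI; rule has_derivative_eq_rhs[OF sep],
          (rule assms one DERIV_sin DERIV_cos DERIV_minus[OF assms(2)])+)
        (auto simp: rot_map_def rot_frame2_def rot_frame3_def vector_4 fun_eq_iff algebra_simps)
    then show "((\<lambda>q. rot_map u v q $ i) has_derivative (\<lambda>h. ?D h $ i)) (at p)" ..
  qed
  from partial_eqI[OF this]
  show "partial 1 (rot_map u v) p = rot_map (\<lambda>_. u') (\<lambda>_. v') p"
      "partial 2 (rot_map u v) p = v (p$1) *\<^sub>R rot_frame2 p"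
      "partial 3 (rot_map u v) p = (v (p$1) * cos (p$2)) *\<^sub>R rot_frame3 p"
    by (auto simp: axis_def)
qed

lemma lorentz_scaleR:
  "lorentz (c *\<^sub>R x) y = c * lorentz x y" "lorentz x (c *\<^sub>R y) = c * lorentz x y"
  by (auto simp: lorentz_def algebra_simps)

text \<open>The spherical point is a unit vector orthogonal to both frame vectors, so the Lorentz
  product of two maps of this shape reduces to the Minkowski product of their profiles.\<close>

lemma lorentz_rot:
  "lorentz (rot_map u v p) (rot_map u' v' p) = v (p$1) * v' (p$1) - u (p$1) * u' (p$1)"
  "lorentz (rot_map u v p) (rot_frame2 p) = 0" "lorentz (rot_frame2 p) (rot_map u v p) = 0"
  "lorentz (rot_map u v p) (rot_frame3 p) = 0" "lorentz (rot_frame3 p) (rot_map u v p) = 0"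
  "lorentz (rot_frame2 p) (rot_frame2 p) = 1" "lorentz (rot_frame3 p) (rot_frame3 p) = 1"
  "lorentz (rot_frame2 p) (rot_frame3 p) = 0" "lorentz (rot_frame3 p) (rot_frame2 p) = 0"
proof -
  \<comment> \<open>\<open>algebra\<close> treats sines and cosines as indeterminates, so the
    Pythagorean relations must be supplied.\<close>
  have sc: "(sin (p$2))^2 + (cos (p$2))^2 = 1" "(sin (p$3))^2 + (cos (p$3))^2 = 1" by simp_all
  note defs = lorentz_def rot_map_def rot_frame2_def rot_frame3_def vector_4
  show "lorentz (rot_map u v p) (rot_map u' v' p) = v (p$1) * v' (p$1) - u (p$1) * u' (p$1)"
    using sc unfolding defs by algebra
  show "lorentz (rot_map u v p) (rot_frame2 p) = 0" using sc unfolding defs by algebra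
  then show "lorentz (rot_frame2 p) (rot_map u v p) = 0" by (simp add: lorentz_def mult.commute)
  show "lorentz (rot_map u v p) (rot_frame3 p) = 0" unfolding defs by simp
  then show "lorentz (rot_frame3 p) (rot_map u v p) = 0" by (simp add: lorentz_def mult.commute)
  show "lorentz (rot_frame2 p) (rot_frame2 p) = 1" using sc unfolding defs by algebra
  show "lorentz (rot_frame3 p) (rot_frame3 p) = 1" using sc unfolding defs by algebra
  show "lorentz (rot_frame2 p) (rot_frame3 p) = 0" unfolding defs by simp
  then show "lorentz (rot_frame3 p) (rot_frame2 p) = 0" by (simp add: lorentz_def mult.commute)
qed

lemma open_rot_domain: "open I \<Longrightarrow> open (rot_domain I)"
proof -
  assume "open I"
  have "rot_domain I = (\<lambda>p. p$1) -` I \<inter> (\<lambda>p. cos (p$2)) -` (- {0})"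
    by (auto simp: rot_domain_def)
  then show ?thesis
    using \<open>open I\<close> by (simp add: open_Int open_vimage open_Compl continuous_intros)
qed

text \<open>\<open>deriv\<close> agrees with \<open>dir_deriv 1\<close> wherever the function is
  differentiable, hence on \<open>I\<close>, and smoothness transfers along equality on
  \<open>I\<close>.\<close>

lemma smooth_on_deriv:
  fixes f :: "real \<Rightarrow> real"
  assumes "open I" "smooth_on I f"
  shows "smooth_on I (deriv f)"
proof (rule smooth_on_cong[OF assms(1) smooth_on_dir_deriv[OF assms(2)]])
  show "dir_deriv 1 f s = deriv f s" if "s \<in> I" for s
    using smooth_on_differentiable[OF assms(2) that]
    by (intro dir_deriv_real) (simp add: DERIV_deriv_iff_real_differentiable)
qed simp

lemma rot_surface_eq: "rot_surface f = rot_map f (\<lambda>s. s)"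
  by (auto simp: fun_eq_iff rot_surface_def rot_map_def Let_def)

lemma rot_gauss_eq:
  "rot_gauss f = rot_map (\<lambda>s. 1 / sqrt ((deriv f s)^2 - 1)) (\<lambda>s. deriv f s / sqrt ((deriv f s)^2 - 1))"
proof -
  have "rot_gauss f p $ i = rot_map (\<lambda>s. 1 / sqrt ((deriv f s)^2 - 1))
      (\<lambda>s. deriv f s / sqrt ((deriv f s)^2 - 1)) p $ i" for p i
    using exhaust_4[of i] by (auto simp: rot_gauss_def rot_map_def vector_4 Let_def)
  then show ?thesis by (simp add: fun_eq_iff vec_eq_iff)
qed

text \<open>The name \<open>spacelike\<close> refers to the unit normal, whose Lorentz square is
  \<open>1\<close>; the profile curve itself is timelike, with square
  \<open>1 - f'^2 < 0\<close>.\<close>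

locale profile_curve =
  fixes I :: "real set" and f :: "real \<Rightarrow> real"
  assumes open_I: "open I" and I_nonzero: "0 \<notin> I" and f_smooth: "smooth_on I f"
    and spacelike: "\<And>s. s \<in> I \<Longrightarrow> (deriv f s)^2 > 1"
begin

abbreviation f1 where "f1 \<equiv> deriv f"
abbreviation f2 where "f2 \<equiv> (deriv ^^ 2) f"
abbreviation f3 where "f3 \<equiv> (deriv ^^ 3) f"

definition W :: "real \<Rightarrow> real" where "W s = sqrt ((f1 s)^2 - 1)"

lemma W_sq: "s \<in> I \<Longrightarrow> (W s)^2 = (f1 s)^2 - 1"
  using spacelike[of s] by (simp add: W_def)

lemma W_pos: "s \<in> I \<Longrightarrow> W s > 0"
  using spacelike[of s] by (simp add: W_def)

lemma f1_nonzero: "s \<in> I \<Longrightarrow> f1 s \<noteq> 0"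
  using spacelike[of s] by auto

lemma smooth_f1: "smooth_on I f1"
  and smooth_f2: "smooth_on I f2"
  and smooth_f3: "smooth_on I f3"
  using smooth_on_deriv[OF open_I] f_smooth by (simp_all add: numeral_eq_Suc)

lemma
  assumes "s \<in> I"
  shows DERIV_f: "(f has_real_derivative f1 s) (at s)"
    and DERIV_f1: "(f1 has_real_derivative f2 s) (at s)"
    and DERIV_f2: "(f2 has_real_derivative f3 s) (at s)"
proof -
  have D: "(h has_real_derivative deriv h s) (at s)" if "smooth_on I h" for h
    using smooth_on_differentiable[OF that assms] DERIV_deriv_iff_real_differentiable by blast
  show "(f has_real_derivative f1 s) (at s)" "(f1 has_real_derivative f2 s) (at s)"
    "(f2 has_real_derivative f3 s) (at s)"
    using D[OF f_smooth] D[OF smooth_f1] D[OF smooth_f2] by (simp_all add: numeral_eq_Suc)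
qed

lemma DERIV_W: "s \<in> I \<Longrightarrow> (W has_real_derivative f1 s * f2 s / W s) (at s)"
  unfolding W_def using spacelike[of s]
  by (auto intro!: derivative_eq_intros DERIV_f1 simp: field_simps)

text \<open>First and second derivatives of the radial factors of the Gauss map. Keeping
  \<open>W\<close> as a symbol makes them rational in \<open>W\<close> and the derivatives of
  \<open>f\<close>, as the later polynomial identities require.\<close>

lemma
  assumes "s \<in> I"
  shows DERIV_N1: "((\<lambda>s. 1 / W s) has_real_derivative - f1 s * f2 s / W s ^ 3) (at s)"
    and DERIV_N: "((\<lambda>s. f1 s / W s) has_real_derivative - f2 s / W s ^ 3) (at s)"
    and DERIV_N1': "((\<lambda>s. - f1 s * f2 s / W s ^ 3) has_real_derivative
      3 * f1 s ^ 2 * f2 s ^ 2 / W s ^ 5 - (f2 s ^ 2 + f1 s * f3 s) / W s ^ 3) (at s)"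
    and DERIV_N': "((\<lambda>s. - f2 s / W s ^ 3) has_real_derivative
      3 * f1 s * f2 s ^ 2 / W s ^ 5 - f3 s / W s ^ 3) (at s)"
proof -
  have W: "W s \<noteq> 0" "f1 s ^ 2 = W s ^ 2 + 1" using W_pos[OF assms] W_sq[OF assms] by auto
  note D = DERIV_f1[OF assms] DERIV_f2[OF assms] DERIV_W[OF assms]
  show "((\<lambda>s. 1 / W s) has_real_derivative - f1 s * f2 s / W s ^ 3) (at s)"
    using W(1) by (auto intro!: derivative_eq_intros D simp: divide_simps power3_eq_cube)
  \<comment> \<open>The numerator contains \<open>W^2 - f'^2\<close>, which is
    \<open>-1\<close>.\<close>
  have "(f2 s * W s - f1 s * (f1 s * f2 s / W s)) / (W s * W s) = - f2 s / W s ^ 3"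
    using W(1) by (simp add: divide_simps) (use W(2) in algebra)
  then show "((\<lambda>s. f1 s / W s) has_real_derivative - f2 s / W s ^ 3) (at s)"
    using DERIV_divide[OF D(1,3) W(1)] by simp
  show "((\<lambda>s. - f1 s * f2 s / W s ^ 3) has_real_derivative
      3 * f1 s ^ 2 * f2 s ^ 2 / W s ^ 5 - (f2 s ^ 2 + f1 s * f3 s) / W s ^ 3) (at s)"
    using W(1) by (auto intro!: derivative_eq_intros D simp: divide_simps) algebra
  show "((\<lambda>s. - f2 s / W s ^ 3) has_real_derivative
      3 * f1 s * f2 s ^ 2 / W s ^ 5 - f3 s / W s ^ 3) (at s)"
    using W(1) by (auto intro!: derivative_eq_intros D simp: divide_simps) algebra
qed

section \<open>Metric and shape operator of the rotational hypersurface\<close>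

abbreviation U where "U \<equiv> rot_domain I"
abbreviation X where "X \<equiv> rot_surface f"
abbreviation N where "N \<equiv> rot_gauss f"

lemma N_eq: "N = rot_map (\<lambda>s. 1 / W s) (\<lambda>s. f1 s / W s)"
  by (simp add: rot_gauss_eq W_def)

lemma U_D:
  assumes "p \<in> U"
  shows "p$1 \<in> I" "p$1 \<noteq> 0" "cos (p$2) \<noteq> 0" "W (p$1) \<noteq> 0"
  using assms I_nonzero W_pos[of "p$1"] by (auto simp: rot_domain_def)

lemma smooth_W: "smooth_on I W"
  unfolding W_def using spacelike open_I
  by (intro smooth_on_compose[OF open_I _ smooth_on_sqrt] smooth_on_diff smooth_on_power smooth_f1
      smooth_on_const) auto

lemma smooth_X: "smooth_on U X"
  unfolding rot_surface_eq
  using open_I f_smooth smooth_on_bounded_linear[OF open_I bounded_linear_ident]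
  by (intro smooth_on_rot_map[OF open_I open_rot_domain]) (auto dest: U_D)

lemma smooth_N: "smooth_on U N"
  unfolding N_eq using open_I smooth_f1 smooth_W W_pos
  by (intro smooth_on_rot_map[OF open_I open_rot_domain] smooth_on_divide smooth_on_const)
    (auto dest: U_D simp: less_imp_neq[THEN not_sym])

lemmas X_differentiable = smooth_on_differentiable[OF smooth_X]
lemmas N_differentiable = smooth_on_differentiable[OF smooth_N]

lemma partial_X:
  assumes "p \<in> U"
  shows "partial 1 X p = rot_map f1 (\<lambda>_. 1) p"
    "partial 2 X p = (p$1) *\<^sub>R rot_frame2 p"
    "partial 3 X p = (p$1 * cos (p$2)) *\<^sub>R rot_frame3 p"
  using partial_rot_map[OF DERIV_f DERIV_ident, of p] U_D[OF assms]
  by (auto simp: rot_surface_eq) (auto simp: rot_map_def)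

text \<open>The derivatives of \<open>1 / W\<close> and \<open>f' / W\<close> are
  \<open>- f'' / W^3\<close> times \<open>f'\<close> and \<open>1\<close>, that is, times the
  tangent of the profile curve. Hence each derivative of \<open>N\<close> is parallel to the
  corresponding derivative of \<open>X\<close>.\<close>

lemma partial_N:
  assumes "p \<in> U"
  shows "partial 1 N p = - (f2 (p$1) / W (p$1) ^ 3) *\<^sub>R rot_map f1 (\<lambda>_. 1) p"
    "partial 2 N p = (f1 (p$1) / W (p$1)) *\<^sub>R rot_frame2 p"
    "partial 3 N p = (f1 (p$1) / W (p$1) * cos (p$2)) *\<^sub>R rot_frame3 p"
  using partial_rot_map[OF DERIV_N1 DERIV_N, of p] U_D[OF assms]
  by (auto simp: N_eq) (auto simp: rot_map_def vec_eq_iff forall_4 vector_4)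

definition metric_diag :: "real^3 \<Rightarrow> real^3" where
  "metric_diag p = vector [1 - (f1 (p$1))^2, (p$1)^2, (p$1)^2 * (cos (p$2))^2]"

lemma induced_metric_X: "p \<in> U \<Longrightarrow> induced_metric X p = diag (metric_diag p)"
  by (simp add: vec_eq_iff forall_3 induced_metric_def diag_def partial_X lorentz_scaleR lorentz_rot
      metric_diag_def power2_eq_square)

lemma metric_diag_nonzero: "p \<in> U \<Longrightarrow> metric_diag p $ i \<noteq> 0"
  using U_D[of p] spacelike[of "p$1"] exhaust_3[of i] by (auto simp: metric_diag_def)

lemma X_regular:
  assumes "p \<in> U"
  shows "invertible (induced_metric X p)" "inj (frechet_derivative X (at p))"
proof -
  show "invertible (induced_metric X p)"
    unfolding induced_metric_X[OF assms] by (rule invertible_diag) (rule metric_diag_nonzero[OF assms])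
  then show "inj (frechet_derivative X (at p))"
    by (rule inj_if_invertible_induced_metric[OF X_differentiable[OF assms]])
qed

lemma hypersurface_rot: "I \<noteq> {} \<Longrightarrow> hypersurface U X N"
proof -
  assume "I \<noteq> {}"
  then obtain s where "s \<in> I" by auto
  \<comment> \<open>At \<open>t = 0\<close> the cosine is \<open>1\<close>, so the parametrization
    is regular there.\<close>
  then have "vector [s, 0, 0] \<in> U" by (simp add: rot_domain_def)
  moreover have "lorentz (N p) (partial i X p) = 0" if "p \<in> U" for p i
    using exhaust_3[of i] U_D[OF that]
    by (auto simp: partial_X[OF that] N_eq lorentz_scaleR lorentz_rot)
  moreover have "lorentz (N p) (N p) = 1" if "p \<in> U" for p
    using U_D(4)[OF that] W_sq[OF U_D(1)[OF that]]
    by (simp add: N_eq lorentz_rot field_simps power2_eq_square)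
  ultimately show ?thesis
    unfolding hypersurface_def using open_rot_domain[OF open_I] smooth_X smooth_N X_regular by blast
qed

lemma shape_operator_rot:
  assumes "p \<in> U"
  shows "shape_operator X N p = diag (vector [f2 (p$1) / W (p$1) ^ 3,
    - f1 (p$1) / (p$1 * W (p$1)), - f1 (p$1) / (p$1 * W (p$1))])"
proof (rule shape_operator_diag[OF X_differentiable N_differentiable])
  show "inj (frechet_derivative X (at p))"
    by (rule X_regular(2)[OF assms])
  show "partial i N p = - (vector [f2 (p$1) / W (p$1) ^ 3, - f1 (p$1) / (p$1 * W (p$1)),
    - f1 (p$1) / (p$1 * W (p$1))] $ i) *\<^sub>R partial i X p" for i
    using exhaust_3[of i] U_D[OF assms]
    by (auto simp: partial_N[OF assms] partial_X[OF assms] field_simps)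
qed (use assms in auto)

end

text \<open>Here \<open>a\<close>, \<open>b\<close>, \<open>c\<close> stand for the first three derivatives of the profile function and \<open>W\<close>
  for \<open>sqrt (a^2 - 1)\<close>; the left-hand sides are the radial parts of \<open>L\<^sub>1\<close> applied to \<open>a / W\<close> times
  a spherical harmonic of degree one, and to \<open>1 / W\<close>.\<close>

lemma
  fixes a b c s W :: real
  assumes nz: "s \<noteq> 0" "a \<noteq> 0" "W \<noteq> 0" and W: "W^2 = a^2 - 1"
  defines "M \<equiv> 2 * (3 * a^4 * (1 - a^2) + a^8 - s * a^5 * b + s^2 * b^2
    + (4 * s^2 * b^2 - 1) * a^2 + s^2 * a * c + s * a^3 * (b - s * c))"
  shows L1_radial_harmonic:
      "2 * a / (s * W) * ((3 * a * b^2 / W^5 - c / W^3) / (-(W^2))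
          - (- b / W^3) * (- 2 * a * b) / (2 * (-(W^2))^2))
        - (b / W^3 - a / (s * W)) * (2 * (- b / W^3) / (s * (-(W^2))) - 2 * (a / W) / s^2)
      = - M / (s^3 * a * W^7) * (a / W)"
    and L1_radial_const:
      "2 * a / (s * W) * ((3 * a^2 * b^2 / W^5 - (b^2 + a * c) / W^3) / (-(W^2))
          - (- a * b / W^3) * (- 2 * a * b) / (2 * (-(W^2))^2))
        - (b / W^3 - a / (s * W)) * (2 * (- a * b / W^3) / (s * (-(W^2))))
      = - M / (s^3 * a * W^7) * (1 / W)
        + (2 * (a * ((a^2 - 1)^2 - 3 * s^2 * b^2) + s^2 * (a^2 - 1) * c) * a - 2 * s^2 * b^2)
          / (s^3 * a * (W^2)^3)"
  \<comment> \<open>Clearing denominators leaves polynomial identities that hold modulo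
    \<open>W^2 = a^2 - 1\<close>.\<close>
  unfolding M_def using nz by (simp_all add: divide_simps) (use W in algebra)+

section \<open>\<open>L_op 1\<close> on separable functions\<close>

context profile_curve
begin

lemma metric_diag_component:
  "(\<lambda>p. metric_diag p $ 1) = separable (\<lambda>s. 1 - (f1 s)^2) (\<lambda>_. 1) (\<lambda>_. 1)"
  "(\<lambda>p. metric_diag p $ 2) = separable (\<lambda>s. s^2) (\<lambda>_. 1) (\<lambda>_. 1)"
  "(\<lambda>p. metric_diag p $ 3) = separable (\<lambda>s. s^2) (\<lambda>t. (cos t)^2) (\<lambda>_. 1)"
  by (auto simp: metric_diag_def separable_def)

text \<open>The hypothesis \<open>angular\<close> says that \<open>b t * c w\<close> is an eigenfunction of the Laplacian of the
  unit sphere.\<close>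

lemma L_op_separable:
  assumes p: "p \<in> U"
    and a: "\<And>s. s \<in> I \<Longrightarrow> (a has_real_derivative a1 s) (at s)"
      "\<And>s. s \<in> I \<Longrightarrow> (a1 has_real_derivative a2 s) (at s)"
    and b: "\<And>t. (b has_real_derivative b1 t) (at t)" "\<And>t. (b1 has_real_derivative b2 t) (at t)"
    and c: "\<And>w. (c has_real_derivative c1 w) (at w)" "\<And>w. (c1 has_real_derivative c2 w) (at w)"
    and angular: "\<And>t w. cos t \<noteq> 0 \<Longrightarrow>
      b2 t * c w - sin t / cos t * b1 t * c w + b t * c2 w / (cos t)^2 = lam * (b t * c w)"
  defines "s \<equiv> p$1" and "t \<equiv> p$2" and "w \<equiv> p$3"
  shows "L_op 1 X N (separable a b c) p =
    (2 * f1 s / (s * W s) * (a2 s / (-(W s ^ 2)) - a1 s * (- 2 * f1 s * f2 s) / (2 * (-(W s ^ 2))^2))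
     - (f2 s / W s ^ 3 - f1 s / (s * W s)) * (2 * a1 s / (s * (-(W s ^ 2))) + lam * a s / s^2))
    * b t * c w"
proof -
  let ?E = metric_diag and ?\<phi> = "separable a b c"
  \<comment> \<open>The gradient components on \<open>U\<close>. Each is again separable, so the
    second derivatives follow from the same product formulas.\<close>
  define V where "V i = (if i = 1 then separable (\<lambda>s. a1 s / (1 - (f1 s)^2)) b c
    else if i = 2 then separable (\<lambda>s. a s / s^2) b1 c
    else separable (\<lambda>s. a s / s^2) (\<lambda>t. b t / (cos t)^2) c1)" for i :: 3
  have s: "s \<in> I" "s \<noteq> 0" "cos t \<noteq> 0" "W s \<noteq> 0" and W: "1 - (f1 s)^2 = - (W s ^ 2)"
    using U_D[OF p] W_sq by (auto simp: s_def t_def)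
  have one: "((\<lambda>_. 1) has_real_derivative 0) (at x)" for x :: real by simp
  have grad: "partial i ?\<phi> q / ?E q $ i = V i q" if "q \<in> U" for q i
    using exhaust_3[of i] U_D[OF that] partial_separable[OF a(1) b(1) c(1), of q]
    by (auto simp: V_def metric_diag_def separable_def)
  have e: "((\<lambda>s. 1 - (f1 s)^2) has_real_derivative - 2 * f1 s * f2 s) (at s)"
    using DERIV_f1[OF s(1)] by (auto intro!: derivative_eq_intros)
  have sq: "((\<lambda>s. s^2) has_real_derivative 2 * s) (at s)"
    by (auto intro!: derivative_eq_intros)
  have cs: "((\<lambda>t. (cos t)^2) has_real_derivative - 2 * sin t * cos t) (at t)"
    by (auto intro!: derivative_eq_intros)
  have V1: "((\<lambda>s. a1 s / (1 - (f1 s)^2)) has_real_derivative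
      a2 s / (-(W s ^ 2)) - a1 s * (- 2 * f1 s * f2 s) / (-(W s ^ 2))^2) (at s)"
    by (rule DERIV_cong[OF DERIV_divide[OF a(2)[OF s(1)] e]])
      (use s(4) in \<open>simp_all only: W, simp_all add: divide_simps power2_eq_square\<close>)
  have V2: "((\<lambda>s. a s / s^2) has_real_derivative (a1 s * s^2 - a s * (2 * s)) / (s^2 * s^2)) (at s)"
    using DERIV_divide[OF a(1)[OF s(1)] sq] s by simp
  have V3: "((\<lambda>t. b t / (cos t)^2) has_real_derivative
      (b1 t * (cos t)^2 - b t * (- 2 * sin t * cos t)) / ((cos t)^2 * (cos t)^2)) (at t)"
    using DERIV_divide[OF b(1) cs] s by simp
  have E1: "(\<lambda>p. metric_diag p $ 1) differentiable (at p)"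
    "partial 1 (\<lambda>p. metric_diag p $ 1) p = - 2 * f1 s * f2 s"
    "partial 2 (\<lambda>p. metric_diag p $ 1) p = 0" "partial 3 (\<lambda>p. metric_diag p $ 1) p = 0"
    using separable_differentiable[OF e[unfolded s_def] one one]
      partial_separable[OF e[unfolded s_def] one one]
    by (simp_all add: metric_diag_component s_def)
  have E2: "(\<lambda>p. metric_diag p $ 2) differentiable (at p)"
    "partial 1 (\<lambda>p. metric_diag p $ 2) p = 2 * s"
    "partial 2 (\<lambda>p. metric_diag p $ 2) p = 0" "partial 3 (\<lambda>p. metric_diag p $ 2) p = 0"
    using separable_differentiable[OF sq[unfolded s_def] one one]
      partial_separable[OF sq[unfolded s_def] one one]
    by (simp_all add: metric_diag_component s_def)
  have E3: "(\<lambda>p. metric_diag p $ 3) differentiable (at p)"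
    "partial 1 (\<lambda>p. metric_diag p $ 3) p = 2 * s * (cos t)^2"
    "partial 2 (\<lambda>p. metric_diag p $ 3) p = s^2 * (- 2 * sin t * cos t)"
    "partial 3 (\<lambda>p. metric_diag p $ 3) p = 0"
    using separable_differentiable[OF sq[unfolded s_def] cs[unfolded t_def] one]
      partial_separable[OF sq[unfolded s_def] cs[unfolded t_def] one]
    by (simp_all add: metric_diag_component s_def t_def)
  have V: "V i differentiable (at p)" for i
    using exhaust_3[of i] separable_differentiable[OF V1[unfolded s_def] b(1) c(1)]
      separable_differentiable[OF V2[unfolded s_def] b(2) c(1)]
      separable_differentiable[OF V2[unfolded s_def] V3[unfolded t_def] c(2)]
    by (auto simp: V_def)
  note U_p = open_rot_domain[OF open_I] p
  have dV: "partial i (\<lambda>q. partial i ?\<phi> q / ?E q $ i) p = partial i (V i) p" for i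
    by (rule partial_cong_open[OF U_p V, symmetric]) (simp add: grad)
  have "(\<lambda>q. partial i ?\<phi> q / ?E q $ i) differentiable (at p)" for i
    by (rule dir_deriv_cong_open(2)[OF U_p V]) (simp add: grad)
  moreover have "(\<lambda>q. ?E q $ i) differentiable (at p)" for i
    using exhaust_3[of i] E1(1) E2(1) E3(1) by auto
  ultimately have trace: "trace (diag d ** hessian_operator (induced_metric X) ?\<phi> p) =
    (\<Sum>i\<in>UNIV. d $ i * (partial i (V i) p +
      (\<Sum>k\<in>UNIV. partial k (\<lambda>q. ?E q $ i) p / (2 * ?E p $ i) * V k p)))" for d
    by (subst trace_diag_hessian[OF U_p induced_metric_X metric_diag_nonzero])
      (simp_all only: dV grad[OF p])
  \<comment> \<open>The metric is independent of \<open>w\<close>, so only these two gradient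
    components multiply a derivative of the metric.\<close>
  have Vp: "V 1 p = a1 s / (-(W s ^ 2)) * b t * c w" "V 2 p = a s / s^2 * b1 t * c w"
    using W by (auto simp: V_def separable_def s_def t_def w_def)
  have dVp: "partial 1 (V 1) p =
      (a2 s / (-(W s ^ 2)) - a1 s * (- 2 * f1 s * f2 s) / (-(W s ^ 2))^2) * b t * c w"
    "partial 2 (V 2) p = a s / s^2 * b2 t * c w"
    "partial 3 (V 3) p = a s / s^2 * (b t / (cos t)^2) * c2 w"
    using partial_separable(1)[OF V1[unfolded s_def] b(1) c(1)]
      partial_separable(2)[OF V2[unfolded s_def] b(2) c(1)]
      partial_separable(3)[OF V2[unfolded s_def] V3[unfolded t_def] c(2)]
    by (auto simp: V_def s_def t_def w_def)
  have Ep: "?E p $ 1 = -(W s ^ 2)" "?E p $ 2 = s^2" "?E p $ 3 = s^2 * (cos t)^2"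
    using W by (simp_all add: metric_diag_def s_def t_def)
  let ?k1 = "f2 s / W s ^ 3" and ?k2 = "- f1 s / (s * W s)"
  \<comment> \<open>The weights are the entries of \<open>P_1\<close>: \<open>-2 k2\<close> in the
    profile direction and \<open>-(k1 + k2)\<close> in both spherical directions, as the last two
    curvatures coincide.\<close>
  have "L_op 1 X N ?\<phi> p = - (2 * ?k2) * (partial 1 (V 1) p +
      (- 2 * f1 s * f2 s) / (2 * (-(W s ^ 2))) * V 1 p)
    - (?k1 + ?k2) * (partial 2 (V 2) p + 2 * s / (2 * s^2) * V 1 p)
    - (?k1 + ?k2) * (partial 3 (V 3) p + 2 * s * (cos t)^2 / (2 * (s^2 * (cos t)^2)) * V 1 p
      + s^2 * (- 2 * sin t * cos t) / (2 * (s^2 * (cos t)^2)) * V 2 p)"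
    unfolding L_op_def shape_operator_rot[OF p] newton_transformation_diag_1 trace
    by (simp add: sum_3 E1 E2 E3 Ep flip: s_def t_def) (simp add: algebra_simps)
  also have "\<dots> = (2 * f1 s / (s * W s) *
      (a2 s / (-(W s ^ 2)) - a1 s * (- 2 * f1 s * f2 s) / (2 * (-(W s ^ 2))^2)) * b t * c w
     - (f2 s / W s ^ 3 - f1 s / (s * W s)) * (2 * a1 s / (s * (-(W s ^ 2))) * b t * c w + a s / s^2 *
       (b2 t * c w - sin t / cos t * b1 t * c w + b t * c2 w / (cos t)^2)))"
  proof -
    \<comment> \<open>The first three are Christoffel symbols. In the fourth, the radial Christoffel
      term cancels half of the quotient-rule term of \<open>V 1\<close>. The terms not containing
      \<open>a1\<close> then gather into the left-hand side of \<open>angular\<close>.\<close>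
    have "2 * s / (2 * s^2) = 1 / s" "2 * s * (cos t)^2 / (2 * (s^2 * (cos t)^2)) = 1 / s"
      "s^2 * (- 2 * sin t * cos t) / (2 * (s^2 * (cos t)^2)) = - (sin t / cos t)"
      "a1 s * (- 2 * f1 s * f2 s) / (-(W s ^ 2))^2 + 
       - ((- 2 * f1 s * f2 s) / (2 * (-(W s ^ 2))) * (a1 s / (-(W s ^ 2))))
       = a1 s * (- 2 * f1 s * f2 s) / (2 * (-(W s ^ 2))^2)"
      using s by (simp_all add: power2_eq_square)
    then show ?thesis
      unfolding Vp dVp by (simp add: algebra_simps)
  qed
  also note angular[OF s(3)]
  finally show ?thesis by (simp add: algebra_simps)
qed

section \<open>The functions \<open>rot_m\<close> and \<open>rot_n\<close> and the equation for the
  Gauss map\<close>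

lemma rot_m_W:
  assumes "s \<in> I"
  shows "rot_m f s = - (2 * (3 * f1 s^4 * (1 - f1 s^2) + f1 s^8 - s * f1 s^5 * f2 s
    + s^2 * f2 s^2 + (4 * s^2 * f2 s^2 - 1) * f1 s^2 + s^2 * f1 s * f3 s
    + s * f1 s^3 * (f2 s - s * f3 s))) / (s^3 * f1 s * W s ^ 7)"
proof -
  \<comment> \<open>\<open>W\<close> is the power \<open>1/2\<close> of a positive base, so
    exponents multiply.\<close>
  have "((f1 s)^2 - 1) powr (7/2) = W s ^ 7"
    using spacelike[OF assms] by (simp add: W_def powr_half_sqrt[symmetric] powr_power)
  then show ?thesis by (simp only: rot_m_def Let_def minus_divide_left)
qed

lemma rot_n_W:
  assumes "s \<in> I" "C1 \<noteq> 0"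
  shows "rot_n C1 f s * C1 = (2 * (f1 s * ((f1 s^2 - 1)^2 - 3 * s^2 * f2 s^2)
    + s^2 * (f1 s^2 - 1) * f3 s) * f1 s - 2 * s^2 * f2 s^2) / (s^3 * f1 s * (W s ^ 2) ^ 3)"
  using assms by (simp add: rot_n_def W_sq Let_def)

lemma smooth_rot_m: "smooth_on I (rot_m f)"
proof -
  have "smooth_on I (\<lambda>s. s)" by (rule smooth_on_bounded_linear[OF open_I bounded_linear_ident])
  then show ?thesis
    unfolding rot_m_def[abs_def] Let_def using I_nonzero f1_nonzero spacelike
    by (intro smooth_on_divide smooth_on_uminus smooth_on_add smooth_on_diff smooth_on_mult
        smooth_on_power smooth_on_const smooth_on_compose[OF open_I _ smooth_on_powr]
        open_I smooth_f1 smooth_f2 smooth_f3) force+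
qed

lemma smooth_rot_n: "C1 \<noteq> 0 \<Longrightarrow> smooth_on I (rot_n C1 f)"
proof -
  assume "C1 \<noteq> 0"
  have "smooth_on I (\<lambda>s. s)" by (rule smooth_on_bounded_linear[OF open_I bounded_linear_ident])
  then show ?thesis
    unfolding rot_n_def[abs_def] Let_def using I_nonzero f1_nonzero spacelike \<open>C1 \<noteq> 0\<close>
    by (intro smooth_on_divide smooth_on_add smooth_on_diff smooth_on_mult
        smooth_on_power smooth_on_const open_I smooth_f1 smooth_f2 smooth_f3) force+
qed

lemma smooth_on_radial: "smooth_on I h \<Longrightarrow> smooth_on U (\<lambda>p. h (p$1))"
  for h :: "real \<Rightarrow> real"
  by (rule smooth_on_compose[OF open_rot_domain[OF open_I]
        smooth_on_bounded_linear[OF open_rot_domain[OF open_I] bounded_linear_vec_nth]])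
    (auto dest: U_D)

lemma L_N:
  assumes p: "p \<in> U" and "C1 \<noteq> 0"
  shows "L_vec 1 X N N p = rot_m f (p$1) *\<^sub>R N p + rot_n C1 f (p$1) *\<^sub>R vector [C1, 0, 0, 0]"
proof -
  define s where "s = p$1"
  have s: "s \<in> I" "s \<noteq> 0" "f1 s \<noteq> 0" "W s \<noteq> 0" "(W s)^2 = (f1 s)^2 - 1"
    using U_D[OF p] f1_nonzero W_sq by (auto simp: s_def)
  \<comment> \<open>The signs of the second and third components go into the angular factor, so that
    the three spatial components share the radial factor \<open>f' / W\<close>.\<close>
  have comp: "(\<lambda>q. N q $ 1) = separable (\<lambda>s. 1 / W s) (\<lambda>_. 1) (\<lambda>_. 1)"
    "(\<lambda>q. N q $ 2) = separable (\<lambda>s. f1 s / W s) (\<lambda>t. - cos t) sin"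
    "(\<lambda>q. N q $ 3) = separable (\<lambda>s. f1 s / W s) (\<lambda>t. - sin t) (\<lambda>_. 1)"
    "(\<lambda>q. N q $ 4) = separable (\<lambda>s. f1 s / W s) cos cos"
    unfolding N_eq rot_map_component by (auto simp: separable_def)
  have const: "((\<lambda>_. k) has_real_derivative 0) (at x)" for k x :: real by simp
  have msin: "((\<lambda>t. - sin t) has_real_derivative - cos x) (at x)"
    and mcos: "((\<lambda>t. - cos t) has_real_derivative sin x) (at x)" for x :: real
    by (auto intro!: derivative_eq_intros)
  \<comment> \<open>Both angular factors are constant, giving eigenvalue \<open>0\<close>. Only this
    component sees \<open>C\<close>, through the product of \<open>rot_n\<close> and
    \<open>C1\<close>.\<close>
  have one: "L_op 1 X N (\<lambda>q. N q $ 1) p = rot_m f s * (1 / W s) + rot_n C1 f s * C1"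
    unfolding comp rot_m_W[OF s(1)] rot_n_W[OF s(1) assms(2)]
    by (subst L_op_separable[OF p DERIV_N1 DERIV_N1' const const const const, where lam = 0])
      (use L1_radial_const[OF s(2-5), of "f2 s" "f3 s"] in \<open>simp_all flip: s_def\<close>)
  have harmonic: "L_op 1 X N (separable (\<lambda>s. f1 s / W s) b c) p =
      rot_m f s * (f1 s / W s) * b (p$2) * c (p$3)"
    if "\<And>t. (b has_real_derivative b1 t) (at t)" "\<And>t. (b1 has_real_derivative b2 t) (at t)"
      "\<And>w. (c has_real_derivative c1 w) (at w)" "\<And>w. (c1 has_real_derivative c2 w) (at w)"
      "\<And>t w. cos t \<noteq> 0 \<Longrightarrow>
        b2 t * c w - sin t / cos t * b1 t * c w + b t * c2 w / (cos t)^2 = - 2 * (b t * c w)"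
    for b c b1 b2 c1 c2
    unfolding rot_m_W[OF s(1)]
    by (subst L_op_separable[OF p DERIV_N DERIV_N' that])
      (use L1_radial_harmonic[OF s(2-5), of "f2 s" "f3 s"] in \<open>simp_all flip: s_def\<close>)
  \<comment> \<open>These are the shapes in which the Pythagorean identity appears once the
    eigenfunction equations with \<open>w\<close>-dependence are cleared of denominators.\<close>
  have pyth: "cos t * (cos t * x) + sin t * (sin t * x) = x" for t x :: real
    using sin_cos_squared_add[of t] by algebra
  have pyth': "cos t * (cos t * (cos t * x)) + cos t * (x * (sin t * sin t)) = cos t * x"
    for t x :: real
    using sin_cos_squared_add[of t] by algebra
  have "L_op 1 X N (\<lambda>q. N q $ 2) p = rot_m f s * N p $ 2"
    unfolding comp fun_cong[OF comp(2)]
    by (subst harmonic[OF mcos DERIV_sin DERIV_sin DERIV_cos])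
      (auto simp: separable_def s_def field_simps power2_eq_square pyth)
  moreover have "L_op 1 X N (\<lambda>q. N q $ 3) p = rot_m f s * N p $ 3"
    unfolding comp fun_cong[OF comp(3)]
    by (subst harmonic[OF msin mcos const const])
      (auto simp: separable_def s_def)
  moreover have "L_op 1 X N (\<lambda>q. N q $ 4) p = rot_m f s * N p $ 4"
    unfolding comp fun_cong[OF comp(4)]
    by (subst harmonic[OF DERIV_cos msin DERIV_cos msin])
      (auto simp: separable_def s_def field_simps power2_eq_square pyth')
  moreover have "N p $ 1 = 1 / W s"
    using fun_cong[OF comp(1)] by (simp add: separable_def s_def)
  ultimately show ?thesis
    using one by (simp add: L_vec_def vec_eq_iff forall_4 vector_4 flip: s_def)
qed

end

theorem theorem7:
  fixes I :: "real set" and f :: "real \<Rightarrow> real" and C1 :: real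
  assumes "open I" and "is_interval I" and "I \<noteq> {}" and "0 \<notin> I"
    and "smooth_on I f"
    and "\<forall>s\<in>I. (deriv f s)^2 > 1"
    and "C1 \<noteq> 0"
    and "\<exists>s\<in>I. rot_m f s \<noteq> 0"
    and "\<exists>s\<in>I. rot_n C1 f s \<noteq> 0"
  shows "generalized_1_type_Gauss_map 1 (rot_domain I) (rot_surface f) (rot_gauss f)
    \<and> generalized_1_type_with 1 (rot_domain I) (rot_surface f) (rot_gauss f)
        (\<lambda>p. rot_m f (p$1)) (\<lambda>p. rot_n C1 f (p$1)) (vector [C1, 0, 0, 0])"
proof -
  interpret profile_curve I f
    using assms by unfold_locales auto
  have "\<exists>p\<in>U. h (p$1) \<noteq> 0" if "\<exists>s\<in>I. h s \<noteq> 0" for h :: "real \<Rightarrow> real"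
  proof -
    from that obtain s where "s \<in> I" "h s \<noteq> 0" by auto
    \<comment> \<open>A nonzero value on \<open>I\<close> is transported to the parameter domain at
      \<open>t = w = 0\<close>, where \<open>cos t\<close> does not vanish.\<close>
    then show ?thesis by (intro bexI[of _ "vector [s, 0, 0]"]) (auto simp: rot_domain_def)
  qed
  moreover have "(vector [C1, 0, 0, 0] :: real^4) \<noteq> 0"
    using \<open>C1 \<noteq> 0\<close> by (metis vector_4(1) zero_index)
  ultimately have "generalized_1_type_with 1 U X N (\<lambda>p. rot_m f (p$1)) (\<lambda>p. rot_n C1 f (p$1))
      (vector [C1, 0, 0, 0])"
    unfolding generalized_1_type_with_def
    using assms smooth_on_radial smooth_rot_m smooth_rot_n L_N by simp
  then show ?thesis
    unfolding generalized_1_type_Gauss_map_def using hypersurface_rot[OF \<open>I \<noteq> {}\<close>] by blast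
qed

end
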